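(* There is a unique Riemannian metric $g^{\mathrm{cl}}$ on $\Omega$ (the metric naturally associated with $\nabla^{\mathrm{cl}}$) satisfying $$g^{\mathrm{cl}}_x\bigl(X_u(x),X_v(x)\bigr)=Q_\Delta(u,v),\qquad x\in\Omega,\ u,v\in V.$$ In coordinates with respect to the clan frame, if $\xi=\sum_{i=1}^5c_iX_{e_i}(x)$ and $\eta=\sum_{i=1}^5d_iX_{e_i}(x)$, then $$g^{\mathrm{cl}}_x(\xi,\eta)=\tfrac32c_1d_1+\tfrac32c_2d_2+2c_3d_3+4c_4d_4+4c_5d_5.$$ Moreover, $\nabla^{\mathrm{cl}}g^{\mathrm{cl}}=0$.
   Context: Let $V\subset \mathrm{Sym}(3,\mathbb{R})$ be the 5-dimensional space of matrices $x=\begin{pmatrix} x_1 & 0 & x_4 \\ 0 & x_2 & x_5 \\ x_4 & x_5 & x_3 \end{pmatrix}$, $x_i\in\mathbb{R}$, with coordinate basis $e_1,\dots,e_5$ ($e_i$ is the matrix with $x_i=1$ and $x_j=0$ for $j\ne i$), and let $\Omega\subset V$ be the open cone of positive definite matrices in $V$. Let $\mathfrak h$ be the space of lower triangular $3\times3$ real matrices with zero $(2,1)$ entry. For $u\in V$ let $\underline{u}\in\mathfrak h$ be the unique element with $u=\underline u+\underline u^{\top}$; the clan product on $V$ is $u\Delta w=\underline u\,w+w\,\underline u^{\top}$, with $L_u(w)=u\Delta w$, and $Q_\Delta(u,v):=\mathrm{tr}(L_{u\Delta v})$. The clan vector field of $v\in V$ on $\Omega$ is $X_v(x)=v\Delta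 x=\underline v\,x+x\,\underline v^{\top}$. The connection $\nabla^{\mathrm{cl}}$ is the unique affine connection on $\Omega$ with $\nabla^{\mathrm{cl}}_{X_u}X_v=0$ for all $u,v\in V$. *)

theory Defs
  imports "HOL-Analysis.Analysis"
begin

section \<open>Calculus and Riemannian geometry on a subset of a Euclidean space\<close>

text \<open>
  Everything here is used for open sets \<open>S\<close> only. All tangent spaces of \<open>S\<close> are identified with
  the ambient vector space. Tensor fields and vector fields are required to be \<open>extensional\<close>,
  i.e. to be \<open>undefined\<close> outside \<open>S\<close>, so that equality of HOL functions is equality on \<open>S\<close>.
\<close>

primrec C_k_on :: "nat \<Rightarrow> 'a::euclidean_space set \<Rightarrow> ('a \<Rightarrow> 'b::euclidean_space) \<Rightarrow> bool" where
  "C_k_on 0 S f \<longleftrightarrow> continuous_on S f"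
| "C_k_on (Suc k) S f \<longleftrightarrow>
     (\<forall>x\<in>S. f differentiable (at x)) \<and>
     (\<forall>v. C_k_on k S (\<lambda>x. frechet_derivative f (at x) v))"

definition smooth_on :: "'a::euclidean_space set \<Rightarrow> ('a \<Rightarrow> 'b::euclidean_space) \<Rightarrow> bool" where
  "smooth_on S f \<longleftrightarrow> (\<forall>k. C_k_on k S f)"

definition vector_fields :: "'a::euclidean_space set \<Rightarrow> ('a \<Rightarrow> 'a) set" where
  "vector_fields S = {X \<in> extensional S. smooth_on S X}"

definition lie_deriv :: "('a::euclidean_space \<Rightarrow> 'a) \<Rightarrow> ('a \<Rightarrow> real) \<Rightarrow> 'a \<Rightarrow> real" where
  "lie_deriv X f x = frechet_derivative f (at x) (X x)"

definition riemannian_metric ::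
    "'a::euclidean_space set \<Rightarrow> ('a \<Rightarrow> 'a \<Rightarrow> 'a \<Rightarrow> real) \<Rightarrow> bool" where
  "riemannian_metric S g \<longleftrightarrow>
     g \<in> extensional S \<and>
     (\<forall>x\<in>S. bilinear (g x) \<and> (\<forall>u v. g x u v = g x v u) \<and> (\<forall>u. u \<noteq> 0 \<longrightarrow> 0 < g x u u)) \<and>
     (\<forall>u v. smooth_on S (\<lambda>x. g x u v))"

definition affine_connection ::
    "'a::euclidean_space set \<Rightarrow> (('a \<Rightarrow> 'a) \<Rightarrow> ('a \<Rightarrow> 'a) \<Rightarrow> ('a \<Rightarrow> 'a)) \<Rightarrow> bool" where
  "affine_connection S D \<longleftrightarrow>
     D \<in> vector_fields S \<rightarrow>\<^sub>E (vector_fields S \<rightarrow>\<^sub>E vector_fields S) \<and>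
     (\<forall>X\<in>vector_fields S. \<forall>Y\<in>vector_fields S. \<forall>Z\<in>vector_fields S. \<forall>x\<in>S.
        D (\<lambda>y\<in>S. X y + Y y) Z x = D X Z x + D Y Z x \<and>
        D X (\<lambda>y\<in>S. Y y + Z y) x = D X Y x + D X Z x) \<and>
     (\<forall>f. smooth_on S f \<longrightarrow>
        (\<forall>X\<in>vector_fields S. \<forall>Y\<in>vector_fields S. \<forall>x\<in>S.
           D (\<lambda>y\<in>S. f y *\<^sub>R X y) Y x = f x *\<^sub>R D X Y x \<and>
           D X (\<lambda>y\<in>S. f y *\<^sub>R Y y) x = lie_deriv X f x *\<^sub>R Y x + f x *\<^sub>R D X Y x))"

text \<open>The value at \<open>x\<close> of \<open>(\<nabla>\<^sub>X g)(Y, Z)\<close>.\<close>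

definition cov_deriv_metric ::
    "(('a::euclidean_space \<Rightarrow> 'a) \<Rightarrow> ('a \<Rightarrow> 'a) \<Rightarrow> ('a \<Rightarrow> 'a)) \<Rightarrow> ('a \<Rightarrow> 'a \<Rightarrow> 'a \<Rightarrow> real) \<Rightarrow>
      ('a \<Rightarrow> 'a) \<Rightarrow> ('a \<Rightarrow> 'a) \<Rightarrow> ('a \<Rightarrow> 'a) \<Rightarrow> 'a \<Rightarrow> real" where
  "cov_deriv_metric D g X Y Z x =
     lie_deriv X (\<lambda>y. g y (Y y) (Z y)) x - g x (D X Y x) (Z x) - g x (Y x) (D X Z x)"

definition parallel_metric ::
    "'a::euclidean_space set \<Rightarrow> (('a \<Rightarrow> 'a) \<Rightarrow> ('a \<Rightarrow> 'a) \<Rightarrow> ('a \<Rightarrow> 'a)) \<Rightarrow>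
      ('a \<Rightarrow> 'a \<Rightarrow> 'a \<Rightarrow> real) \<Rightarrow> bool" where
  "parallel_metric S D g \<longleftrightarrow>
     (\<forall>X\<in>vector_fields S. \<forall>Y\<in>vector_fields S. \<forall>Z\<in>vector_fields S. \<forall>x\<in>S.
        cov_deriv_metric D g X Y Z x = 0)"


section \<open>The clan\<close>

text \<open>
  The space \<open>V\<close> of matrices is handled through its coordinates \<open>x\<^sub>1, \<dots>, x\<^sub>5\<close>, i.e. as
  \<open>real^5\<close>; \<open>sym_of\<close> is the resulting linear isomorphism onto \<open>V\<close>, and \<open>axis i 1\<close> is the
  basis vector \<open>e\<^sub>i\<close>. (In the index type \<open>5\<close> the numeral \<open>5\<close> is the element \<open>0\<close>.)
\<close>

definition sym_of :: "real^5 \<Rightarrow> real^3^3" where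
  "sym_of x = vector [vector [x $ 1, 0,     x $ 4],
                      vector [0,     x $ 2, x $ 5],
                      vector [x $ 4, x $ 5, x $ 3]]"

definition pd_cone :: "(real^5) set" where
  "pd_cone = {x. \<forall>z. z \<noteq> 0 \<longrightarrow> 0 < z \<bullet> (sym_of x *v z)}"

definition lower_space :: "(real^3^3) set" where
  "lower_space = {h. h $ 1 $ 2 = 0 \<and> h $ 1 $ 3 = 0 \<and> h $ 2 $ 3 = 0 \<and> h $ 2 $ 1 = 0}"

definition lower_part :: "real^5 \<Rightarrow> real^3^3" where
  "lower_part u = (THE h. h \<in> lower_space \<and> sym_of u = h + transpose h)"

definition clan :: "real^5 \<Rightarrow> real^5 \<Rightarrow> real^5" (infixl "\<triangle>" 70) where
  "u \<triangle> w =
     (THE y. sym_of y = lower_part u ** sym_of w + sym_of w ** transpose (lower_part u))"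

definition clan_form :: "real^5 \<Rightarrow> real^5 \<Rightarrow> real" where
  "clan_form u v = trace (matrix (\<lambda>w. (u \<triangle> v) \<triangle> w))"

definition clan_field :: "real^5 \<Rightarrow> real^5 \<Rightarrow> real^5" where
  "clan_field v = (\<lambda>x\<in>pd_cone. v \<triangle> x)"

definition clan_connection ::
    "(real^5 \<Rightarrow> real^5) \<Rightarrow> (real^5 \<Rightarrow> real^5) \<Rightarrow> (real^5 \<Rightarrow> real^5)" where
  "clan_connection =
     (THE D. affine_connection pd_cone D \<and>
        (\<forall>u v. \<forall>x\<in>pd_cone. D (clan_field u) (clan_field v) x = 0))"

definition clan_metric :: "real^5 \<Rightarrow> real^5 \<Rightarrow> real^5 \<Rightarrow> real" where
  "clan_metric =
     (THE g. riemannian_metric pd_cone g \<and>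
        (\<forall>x\<in>pd_cone. \<forall>u v. g x (clan_field u x) (clan_field v x) = clan_form u v))"


section \<open>Well-definedness and coordinate expressions\<close>

lemma exhaust_5: "x = 1 \<or> x = 2 \<or> x = 3 \<or> x = 4 \<or> x = 5" for x :: 5
proof (induct x)
  case (of_int z)
  then have "z = 0 \<or> z = 1 \<or> z = 2 \<or> z = 3 \<or> z = 4" by auto
  then show ?case by auto
qed

lemma forall_5: "(\<forall>i::5. P i) \<longleftrightarrow> P 1 \<and> P 2 \<and> P 3 \<and> P 4 \<and> P 5"
  by (metis exhaust_5)

lemma sum_5: "sum f (UNIV::5 set) = f 1 + f 2 + f 3 + f 4 + f 5"
proof -
  have "UNIV = {1, 2, 3, 4, 5::5}" using exhaust_5 by auto
  show ?thesis unfolding \<open>UNIV = _\<close> by (simp add: ac_simps)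
qed

lemma transpose_eq_self_3:
  "transpose A = A \<longleftrightarrow> A $ 2 $ 1 = A $ 1 $ 2 \<and> A $ 3 $ 1 = A $ 1 $ 3 \<and> A $ 3 $ 2 = A $ 2 $ 3"
  for A :: "'a^3^3"
  unfolding transpose_def vec_eq_iff forall_3 vec_lambda_beta by metis

lemma range_sym_of: "range sym_of = {A. transpose A = A \<and> A $ 1 $ 2 = 0}"
proof (intro equalityI subsetI)
  fix A :: "real^3^3" assume "A \<in> {A. transpose A = A \<and> A $ 1 $ 2 = 0}"
  then have A: "A $ 1 $ 2 = 0" "A $ 2 $ 1 = 0" "A $ 3 $ 1 = A $ 1 $ 3" "A $ 3 $ 2 = A $ 2 $ 3"
    by (simp_all add: transpose_eq_self_3)
  define x :: "real^5" where
    "x = (\<chi> i. if i = 1 then A $ 1 $ 1 else if i = 2 then A $ 2 $ 2 else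
       if i = 3 then A $ 3 $ 3 else if i = 4 then A $ 1 $ 3 else A $ 2 $ 3)"
  have "A = sym_of x"
    using A by (simp add: x_def sym_of_def vec_eq_iff forall_3)
  then show "A \<in> range sym_of" by blast
qed (auto simp: sym_of_def transpose_eq_self_3)

lemma inj_sym_of: "inj sym_of"
  by (rule injI) (simp add: sym_of_def vec_eq_iff forall_3 forall_5)

lemma linear_sym_of: "linear sym_of"
  by (rule linearI) (simp_all add: sym_of_def vec_eq_iff forall_3)

lemma sym_of_eq_iff:
  "sym_of u = h + transpose h \<and> h \<in> lower_space \<longleftrightarrow>
   h = vector [vector [u $ 1 / 2, 0, 0], vector [0, u $ 2 / 2, 0],
      vector [u $ 4, u $ 5, u $ 3 / 2]]"
  unfolding lower_space_def sym_of_def transpose_def vec_eq_iff forall_3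
  by (simp, argo)

lemma lower_part_ex1: "\<exists>!h. h \<in> lower_space \<and> sym_of u = h + transpose h"
  unfolding conj_commute[of "_ \<in> lower_space"] sym_of_eq_iff by blast

lemma lower_part_eq:
  "lower_part u = vector [vector [u $ 1 / 2, 0, 0], vector [0, u $ 2 / 2, 0],
      vector [u $ 4, u $ 5, u $ 3 / 2]]"
  unfolding lower_part_def
  by (rule the1_equality[OF lower_part_ex1]) (use sym_of_eq_iff[of u] in blast)

lemma sym_of_clan:
  "sym_of (u \<triangle> w) = lower_part u ** sym_of w + sym_of w ** transpose (lower_part u)"
proof -
  have "lower_part u ** sym_of w + sym_of w ** transpose (lower_part u) \<in> range sym_of"
    unfolding range_sym_of transpose_eq_self_3 mem_Collect_eq
    by (simp add: lower_part_eq sym_of_def transpose_def matrix_matrix_mult_def sum_3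
        algebra_simps)
  then obtain y where
    y: "sym_of y = lower_part u ** sym_of w + sym_of w ** transpose (lower_part u)"
    by auto
  then show ?thesis
    unfolding clan_def by (rule theI) (metis y inj_sym_of injD)
qed

lemma clan_nth:
  "(u \<triangle> w) $ 1 = u $ 1 * w $ 1"
  "(u \<triangle> w) $ 2 = u $ 2 * w $ 2"
  "(u \<triangle> w) $ 3 = u $ 3 * w $ 3 + 2 * u $ 4 * w $ 4 + 2 * u $ 5 * w $ 5"
  "(u \<triangle> w) $ 4 = (u $ 1 + u $ 3) / 2 * w $ 4 + u $ 4 * w $ 1"
  "(u \<triangle> w) $ 5 = (u $ 2 + u $ 3) / 2 * w $ 5 + u $ 5 * w $ 2"
proof -
  have "sym_of (u \<triangle> w) $ i $ j =
      (lower_part u ** sym_of w + sym_of w ** transpose (lower_part u)) $ i $ j" for i j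
    by (simp only: sym_of_clan)
  note entry = this
  show "(u \<triangle> w) $ 1 = u $ 1 * w $ 1"
    using entry[of 1 1]
    by (simp add: lower_part_eq sym_of_def transpose_def matrix_matrix_mult_def sum_3)
  show "(u \<triangle> w) $ 2 = u $ 2 * w $ 2"
    using entry[of 2 2]
    by (simp add: lower_part_eq sym_of_def transpose_def matrix_matrix_mult_def sum_3)
  show "(u \<triangle> w) $ 3 = u $ 3 * w $ 3 + 2 * u $ 4 * w $ 4 + 2 * u $ 5 * w $ 5"
    using entry[of 3 3]
    by (simp add: lower_part_eq sym_of_def transpose_def matrix_matrix_mult_def sum_3)
  show "(u \<triangle> w) $ 4 = (u $ 1 + u $ 3) / 2 * w $ 4 + u $ 4 * w $ 1"
    using entry[of 1 3]
    by (simp add: lower_part_eq sym_of_def transpose_def matrix_matrix_mult_def sum_3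
        algebra_simps add_divide_distrib)
  show "(u \<triangle> w) $ 5 = (u $ 2 + u $ 3) / 2 * w $ 5 + u $ 5 * w $ 2"
    using entry[of 2 3]
    by (simp add: lower_part_eq sym_of_def transpose_def matrix_matrix_mult_def sum_3
        algebra_simps add_divide_distrib)
qed

lemma clan_form_eq:
  "clan_form u v = 3 / 2 * u $ 1 * v $ 1 + 3 / 2 * u $ 2 * v $ 2 + 2 * u $ 3 * v $ 3
     + 4 * u $ 4 * v $ 4 + 4 * u $ 5 * v $ 5"
  unfolding clan_form_def trace_def matrix_def sum_5
  by (simp add: clan_nth axis_def algebra_simps add_divide_distrib)

end

theory Submission
  imports Defs
begin

text \<open>
  On \<open>pd_cone\<close> the linear map \<open>v \<mapsto> v \<triangle> x\<close> has a smooth inverse \<open>frame_coords x\<close>, because its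
  determinant only involves the pivots of \<open>sym_of x\<close>; so the clan fields of a basis form a global
  smooth frame. Pulling \<open>clan_form\<close> back along \<open>frame_coords\<close> gives the metric, and
  differentiating frame coordinates gives the connection. In these coordinates the metric is the
  constant form \<open>clan_form\<close>, so its being parallel is the product rule.
\<close>

section \<open>Smooth maps\<close>

text \<open>On an open set the values determine the derivatives at its points. This lets a field
  that is \<open>undefined\<close> off \<open>S\<close> inherit regularity from the formula it
  restricts. The functions vary in the induction because it passes to their directional
  derivatives.\<close>

lemma C_k_on_cong:
  assumes "open S" "\<And>x. x \<in> S \<Longrightarrow> f x = g x" "C_k_on k S f"
  shows "C_k_on k S g"
  using assms(2,3)
proof (induction k arbitrary: f g)
  case 0
  then show ?case by (simp cong: continuous_on_cong)
next
  case (Suc k)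
  have der: "(g has_derivative frechet_derivative f (at x)) (at x)" if "x \<in> S" for x
    using that Suc.prems frechet_derivative_works assms(1)
    by (metis (no_types, lifting) C_k_on.simps(2) has_derivative_transform_within_open)
  then have eq: "frechet_derivative f (at x) v = frechet_derivative g (at x) v" if "x \<in> S" for x v
    using that frechet_derivative_at by metis
  show ?case
    unfolding C_k_on.simps
  proof (intro conjI ballI allI)
    show "g differentiable (at x)" if "x \<in> S" for x
      using der[OF that] differentiable_def by blast
    show "C_k_on k S (\<lambda>x. frechet_derivative g (at x) v)" for v
      using Suc.IH[OF eq] Suc.prems(2) by simp
  qed
qed

lemma smooth_on_cong:
  assumes "open S" "\<And>x. x \<in> S \<Longrightarrow> f x = g x" "smooth_on S f"
  shows "smooth_on S g"
  using assms C_k_on_cong unfolding smooth_on_def by blast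

text \<open>Any explicit derivative may replace \<open>frechet_derivative\<close>, so the
  differentiation rules can be used as they stand in the inductions on \<open>k\<close>.\<close>

lemma C_k_on_SucI:
  assumes "open S" "\<And>x. x \<in> S \<Longrightarrow> (f has_derivative f' x) (at x)"
    "\<And>v. C_k_on k S (\<lambda>x. f' x v)"
  shows "C_k_on (Suc k) S f"
  unfolding C_k_on.simps
proof (intro conjI ballI allI)
  show "f differentiable (at x)" if "x \<in> S" for x
    using assms(2)[OF that] differentiable_def by blast
  show "C_k_on k S (\<lambda>x. frechet_derivative f (at x) v)" for v
  proof (rule C_k_on_cong[OF assms(1) _ assms(3)])
    show "f' x v = frechet_derivative f (at x) v" if "x \<in> S" for x
      using frechet_derivative_at[OF assms(2)[OF that]] by simp
  qed
qed

lemma C_k_on_SucD: "C_k_on (Suc k) S f \<Longrightarrow> C_k_on k S f"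
proof (induction k arbitrary: f)
  case 0
  then show ?case
    by (auto intro!: continuous_at_imp_continuous_on differentiable_imp_continuous_within)
next
  case (Suc k)
  then show ?case unfolding C_k_on.simps(2)[of _ S f] by blast
qed

lemma C_k_on_has_derivative:
  "C_k_on (Suc k) S f \<Longrightarrow> x \<in> S \<Longrightarrow> (f has_derivative frechet_derivative f (at x)) (at x)"
  using frechet_derivative_works by auto

lemma smooth_on_has_derivative:
  "smooth_on S f \<Longrightarrow> x \<in> S \<Longrightarrow> (f has_derivative frechet_derivative f (at x)) (at x)"
  using C_k_on_has_derivative unfolding smooth_on_def by blast

lemma smooth_on_const: "open S \<Longrightarrow> smooth_on S (\<lambda>x. c)"
proof -
  assume "open S"
  have "C_k_on k S (\<lambda>x. c)" for k
    by (induction k arbitrary: c) simp_all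
  then show ?thesis by (simp add: smooth_on_def)
qed

lemma smooth_on_linear:
  assumes "open S" "bounded_linear L"
  shows "smooth_on S L"
  unfolding smooth_on_def
proof
  fix k
  show "C_k_on k S L"
  proof (cases k)
    case 0
    then show ?thesis using assms(2) by (simp add: linear_continuous_on)
  next
    case (Suc n)
    have "C_k_on (Suc n) S L"
      using smooth_on_const[OF assms(1)]
      by (intro C_k_on_SucI[where f'="\<lambda>_. L"])
        (auto simp: assms smooth_on_def intro: bounded_linear_imp_has_derivative)
    then show ?thesis using Suc by simp
  qed
qed

section \<open>Sums, bilinear products and reciprocals of maps of class C^k\<close>

lemma C_k_on_add:
  assumes "open S" "C_k_on k S f" "C_k_on k S g"
  shows "C_k_on k S (\<lambda>x. f x + g x)"
  using assms(2,3)
proof (induction k arbitrary: f g)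
  case 0
  then show ?case by (simp add: continuous_on_add)
next
  case (Suc k)
  show ?case
  proof (rule C_k_on_SucI[OF assms(1)])
    show "((\<lambda>x. f x + g x) has_derivative
       (\<lambda>v. frechet_derivative f (at x) v + frechet_derivative g (at x) v)) (at x)"
      if "x \<in> S" for x
      using that Suc.prems by (intro has_derivative_add C_k_on_has_derivative)
    show "C_k_on k S (\<lambda>x. frechet_derivative f (at x) v + frechet_derivative g (at x) v)" for v
      using Suc by simp
  qed
qed

text \<open>The product rule yields a sum of values of the same \<open>h\<close>, so the induction
  closes with \<open>f\<close> and \<open>g\<close> varying. The factor left undifferentiated in
  each term only has to be lowered by one order. Multiplication, scaling, inner product, clan
  product and \<open>clan_form\<close> are all instances.\<close>

lemma C_k_on_bilinear:
  assumes "open S" "bounded_bilinear h" "C_k_on k S f" "C_k_on k S g"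
  shows "C_k_on k S (\<lambda>x. h (f x) (g x))"
  using assms(3,4)
proof (induction k arbitrary: f g)
  case 0
  then show ?case by (simp add: bounded_bilinear.continuous_on[OF assms(2)])
next
  case (Suc k)
  note sub = C_k_on_SucD[OF Suc.prems(1)] C_k_on_SucD[OF Suc.prems(2)]
  show ?case
  proof (rule C_k_on_SucI[OF assms(1)])
    show "((\<lambda>x. h (f x) (g x)) has_derivative
       (\<lambda>v. h (f x) (frechet_derivative g (at x) v) + h (frechet_derivative f (at x) v) (g x))) (at x)"
      if "x \<in> S" for x
      using that Suc.prems by (intro bounded_bilinear.FDERIV[OF assms(2)] C_k_on_has_derivative)
    show "C_k_on k S
       (\<lambda>x. h (f x) (frechet_derivative g (at x) v) + h (frechet_derivative f (at x) v) (g x))" for v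
      using Suc.prems by (intro C_k_on_add assms(1) Suc.IH sub) auto
  qed
qed

text \<open>The derivative of the reciprocal is a product of \<open>inverse (f x)\<close>, which is
  of class C^k by induction, and a derivative of \<open>f\<close>.\<close>

lemma C_k_on_inverse:
  fixes f :: "'a::euclidean_space \<Rightarrow> real"
  assumes "open S" "\<And>x. x \<in> S \<Longrightarrow> f x \<noteq> 0" "C_k_on k S f"
  shows "C_k_on k S (\<lambda>x. inverse (f x))"
  using assms(3)
proof (induction k)
  case 0
  then show ?case using assms(2) by (simp add: continuous_on_inverse)
next
  case (Suc k)
  note inv = Suc.IH[OF C_k_on_SucD[OF Suc.prems]]
  note mult = C_k_on_bilinear[OF assms(1) bounded_bilinear_mult]
  show ?case
  proof (rule C_k_on_SucI[OF assms(1)])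
    show "((\<lambda>x. inverse (f x)) has_derivative
       (\<lambda>v. - 1 * (inverse (f x) * frechet_derivative f (at x) v * inverse (f x)))) (at x)"
      if "x \<in> S" for x
      using Deriv.has_derivative_inverse[OF assms(2)[OF that] C_k_on_has_derivative[OF Suc.prems that]]
      by simp
    have "C_k_on k S (\<lambda>x. - 1 :: real)"
      using smooth_on_const[OF assms(1)] by (auto simp: smooth_on_def)
    then show "C_k_on k S (\<lambda>x. - 1 * (inverse (f x) * frechet_derivative f (at x) v * inverse (f x)))"
      for v
      using Suc.prems by (intro mult inv) auto
  qed
qed

section \<open>Closure properties of smooth maps\<close>

lemma smooth_on_add:
  "open S \<Longrightarrow> smooth_on S f \<Longrightarrow> smooth_on S g \<Longrightarrow> smooth_on S (\<lambda>x. f x + g x)"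
  using C_k_on_add unfolding smooth_on_def by blast

lemma smooth_on_bilinear:
  "open S \<Longrightarrow> bounded_bilinear h \<Longrightarrow> smooth_on S f \<Longrightarrow> smooth_on S g \<Longrightarrow>
    smooth_on S (\<lambda>x. h (f x) (g x))"
  using C_k_on_bilinear unfolding smooth_on_def by blast

lemmas smooth_on_scaleR = smooth_on_bilinear[OF _ bounded_bilinear_scaleR]
lemmas smooth_on_mult = smooth_on_bilinear[OF _ bounded_bilinear_mult]

lemma smooth_on_minus:
  assumes "open S" "smooth_on S f" "smooth_on S g"
  shows "smooth_on S (\<lambda>x. f x - g x)"
proof -
  have "smooth_on S (\<lambda>x. f x + (- 1) *\<^sub>R g x)"
    by (intro smooth_on_add smooth_on_scaleR smooth_on_const assms)
  then show ?thesis by simp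
qed

lemma smooth_on_divide:
  fixes f g :: "'a::euclidean_space \<Rightarrow> real"
  assumes "open S" "smooth_on S f" "smooth_on S g" "\<And>x. x \<in> S \<Longrightarrow> g x \<noteq> 0"
  shows "smooth_on S (\<lambda>x. f x / g x)"
proof -
  have "smooth_on S (\<lambda>x. inverse (g x))"
    using assms C_k_on_inverse unfolding smooth_on_def by blast
  then show ?thesis
    unfolding divide_inverse by (intro smooth_on_mult assms)
qed

lemma smooth_on_sum:
  assumes "open S" "\<And>i. i \<in> I \<Longrightarrow> smooth_on S (f i)"
  shows "smooth_on S (\<lambda>x. \<Sum>i\<in>I. f i x)"
  using assms(2)
  by (induction I rule: infinite_finite_induct)
    (simp_all add: smooth_on_const smooth_on_add assms(1))

lemma smooth_on_nth:
  fixes f :: "'a::euclidean_space \<Rightarrow> real^'n"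
  assumes "open S" "smooth_on S f"
  shows "smooth_on S (\<lambda>x. f x $ i)"
proof -
  have "smooth_on S (\<lambda>x. f x \<bullet> axis i 1)"
    by (intro smooth_on_bilinear[OF _ bounded_bilinear_inner] smooth_on_const assms)
  then show ?thesis by (simp add: inner_axis)
qed

lemma vec_sum_axis: "(\<Sum>i\<in>UNIV. x $ i *\<^sub>R axis i 1) = x" for x :: "real^'n"
  using basis_expansion[of x] by (simp add: scalar_mult_eq_scaleR)

lemma smooth_on_vec:
  fixes f :: "'a::euclidean_space \<Rightarrow> real^'n"
  assumes "open S" "\<And>i. smooth_on S (\<lambda>x. f x $ i)"
  shows "smooth_on S f"
proof -
  have "smooth_on S (\<lambda>x. \<Sum>i\<in>UNIV. f x $ i *\<^sub>R (axis i 1 :: real^'n))"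
    by (intro smooth_on_sum smooth_on_scaleR smooth_on_const assms)
  then show ?thesis by (simp add: vec_sum_axis)
qed

text \<open>\<open>C_k_on\<close> only controls derivatives in fixed directions. A direction that
  varies with the point is expanded in \<open>Basis\<close>, with coefficients that are smooth
  because \<open>X\<close> is.\<close>

lemma smooth_on_directional_derivative:
  assumes "open S" "smooth_on S f" "smooth_on S X"
  shows "smooth_on S (\<lambda>x. frechet_derivative f (at x) (X x))"
proof (rule smooth_on_cong[OF assms(1)])
  have "smooth_on S (\<lambda>x. frechet_derivative f (at x) b)" for b
    using assms(2) unfolding smooth_on_def by (metis C_k_on.simps(2))
  then show "smooth_on S (\<lambda>x. \<Sum>b\<in>Basis. (X x \<bullet> b) *\<^sub>R frechet_derivative f (at x) b)"
    by (intro smooth_on_sum smooth_on_scaleR smooth_on_const assms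
        smooth_on_bilinear[OF _ bounded_bilinear_inner])
  show "(\<Sum>b\<in>Basis. (X x \<bullet> b) *\<^sub>R frechet_derivative f (at x) b) = frechet_derivative f (at x) (X x)"
    if "x \<in> S" for x
  proof -
    have "linear (frechet_derivative f (at x))"
      using smooth_on_has_derivative[OF assms(2) that] has_derivative_linear by blast
    then have "frechet_derivative f (at x) (\<Sum>b\<in>Basis. (X x \<bullet> b) *\<^sub>R b) =
        (\<Sum>b\<in>Basis. (X x \<bullet> b) *\<^sub>R frechet_derivative f (at x) b)"
      by (simp add: linear_sum linear_scale)
    then show ?thesis by (simp add: euclidean_representation)
  qed
qed


section \<open>The clan frame\<close>

text \<open>The Schur complement of the diagonal block with entries \<open>x $ 1\<close> and
  \<open>x $ 2\<close>, that is, the last pivot of \<open>sym_of x\<close>; the determinant is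
  \<open>x $ 1 * x $ 2 * schur x\<close>.\<close>

definition schur :: "real^5 \<Rightarrow> real" where
  "schur x = x $ 3 - (x $ 4)\<^sup>2 / x $ 1 - (x $ 5)\<^sup>2 / x $ 2"

text \<open>Completing the squares in \<open>z $ 1\<close> and \<open>z $ 2\<close>, which are not
  coupled because the (1,2) entry vanishes. It makes positive definiteness equivalent to positivity
  of three pivots.\<close>

lemma quadratic_form_eq:
  assumes "x $ 1 \<noteq> 0" "x $ 2 \<noteq> 0"
  shows "z \<bullet> (sym_of x *v z) = x $ 1 * (z $ 1 + x $ 4 / x $ 1 * z $ 3)\<^sup>2
    + x $ 2 * (z $ 2 + x $ 5 / x $ 2 * z $ 3)\<^sup>2 + schur x * (z $ 3)\<^sup>2"
  using assms
  by (simp add: schur_def sym_of_def inner_vec_def matrix_vector_mult_def sum_3 field_simps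
      power2_eq_square)

lemma pd_cone_eq: "pd_cone = {x. 0 < x $ 1 \<and> 0 < x $ 2 \<and> 0 < schur x}"
proof (intro equalityI subsetI)
  fix x assume "x \<in> pd_cone"
  then have pos: "z \<noteq> 0 \<Longrightarrow> 0 < z \<bullet> (sym_of x *v z)" for z
    by (simp add: pd_cone_def)
  have "0 < x $ 1"
    using pos[of "vector [1, 0, 0]"]
    by (simp add: sym_of_def inner_vec_def matrix_vector_mult_def sum_3 vec_eq_iff forall_3)
  moreover have "0 < x $ 2"
    using pos[of "vector [0, 1, 0]"]
    by (simp add: sym_of_def inner_vec_def matrix_vector_mult_def sum_3 vec_eq_iff forall_3)
  moreover have "0 < schur x"
    \<comment> \<open>This vector makes both completed squares vanish and has last entry 1, so the
      form takes the value \<open>schur x\<close>.\<close>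
    using pos[of "vector [- x $ 4 / x $ 1, - x $ 5 / x $ 2, 1]"] calculation
    by (simp add: quadratic_form_eq vec_eq_iff forall_3)
  ultimately show "x \<in> {x. 0 < x $ 1 \<and> 0 < x $ 2 \<and> 0 < schur x}" by simp
next
  fix x :: "real^5" assume x: "x \<in> {x. 0 < x $ 1 \<and> 0 < x $ 2 \<and> 0 < schur x}"
  have "0 < z \<bullet> (sym_of x *v z)" if "z \<noteq> 0" for z
  proof (cases "z $ 3 = 0")
    case True
    then have "z $ 1 \<noteq> 0 \<or> z $ 2 \<noteq> 0"
      using that by (auto simp: vec_eq_iff forall_3)
    then show ?thesis
      using x True by (auto simp: quadratic_form_eq add_pos_nonneg add_nonneg_pos)
  next
    case False
    then show ?thesis
      using x by (auto simp: quadratic_form_eq intro!: add_nonneg_pos)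
  qed
  then show "x \<in> pd_cone" by (simp add: pd_cone_def)
qed

lemma open_pd_cone: "open pd_cone"
proof -
  have 1: "open {x::real^5. 0 < x $ 1 \<and> 0 < x $ 2}"
    by (intro open_Collect_conj open_Collect_less continuous_intros)
  \<comment> \<open>Since \<open>schur\<close> divides by the first two coordinates, its preimage is
    taken inside the open set where they are positive.\<close>
  have "continuous_on {x::real^5. 0 < x $ 1 \<and> 0 < x $ 2} schur"
    unfolding schur_def by (intro continuous_intros) auto
  then have "open ({x::real^5. 0 < x $ 1 \<and> 0 < x $ 2} \<inter> schur -` {0<..})"
    using 1 by (intro continuous_open_preimage) auto
  also have "\<dots> = pd_cone" unfolding pd_cone_eq by auto
  finally show ?thesis .
qed

text \<open>The inverse of \<open>v \<mapsto> v \<triangle> x\<close>: the coordinates of a tangent vector at \<open>x\<close> in the clan frame.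
  The third one is found by eliminating all other unknowns.\<close>

definition frame_coord3 :: "real^5 \<Rightarrow> real^5 \<Rightarrow> real" where
  "frame_coord3 x u =
     (u $ 3 - (2 * u $ 4 - u $ 1 / x $ 1 * x $ 4) * x $ 4 / x $ 1
            - (2 * u $ 5 - u $ 2 / x $ 2 * x $ 5) * x $ 5 / x $ 2) / schur x"

definition frame_coords :: "real^5 \<Rightarrow> real^5 \<Rightarrow> real^5" where
  "frame_coords x u = vector [u $ 1 / x $ 1, u $ 2 / x $ 2, frame_coord3 x u,
     (u $ 4 - (u $ 1 / x $ 1 + frame_coord3 x u) / 2 * x $ 4) / x $ 1,
     (u $ 5 - (u $ 2 / x $ 2 + frame_coord3 x u) / 2 * x $ 5) / x $ 2]"

section \<open>The clan product with a point of the cone as an invertible linear map\<close>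

lemma vector_5 [simp]:
  "(vector [a, b, c, d, e] :: 'a::zero^5) $ 1 = a"
  "(vector [a, b, c, d, e] :: 'a::zero^5) $ 2 = b"
  "(vector [a, b, c, d, e] :: 'a::zero^5) $ 3 = c"
  "(vector [a, b, c, d, e] :: 'a::zero^5) $ 4 = d"
  "(vector [a, b, c, d, e] :: 'a::zero^5) $ 5 = e"
  unfolding vector_def by simp_all

lemma frame_coords_clan:
  assumes "x \<in> pd_cone"
  shows "frame_coords x (v \<triangle> x) = v"
proof -
  have x: "x $ 1 \<noteq> 0" "x $ 2 \<noteq> 0" "schur x \<noteq> 0" using assms by (auto simp: pd_cone_eq)
  \<comment> \<open>Twice the fourth component minus \<open>v $ 1 * x $ 4\<close> is
    \<open>v $ 3 * x $ 4 + 2 * v $ 4 * x $ 1\<close>. Multiplied by \<open>x $ 4 / x $ 1\<close> and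
    subtracted, it removes \<open>v $ 4\<close> from the third component; the fifth removes
    \<open>v $ 5\<close> likewise. What remains is \<open>v $ 3\<close> times the last
    pivot.\<close>
  have "(v \<triangle> x) $ 3 - (2 * (v \<triangle> x) $ 4 - v $ 1 * x $ 4) * x $ 4 / x $ 1
            - (2 * (v \<triangle> x) $ 5 - v $ 2 * x $ 5) * x $ 5 / x $ 2 = v $ 3 * schur x"
    using x(1,2) by (simp add: clan_nth schur_def field_simps power2_eq_square)
  then have "frame_coord3 x (v \<triangle> x) = v $ 3"
    using x by (simp add: frame_coord3_def clan_nth(1,2))
  then show ?thesis
    using x(1,2) by (simp add: frame_coords_def vec_eq_iff forall_5 clan_nth)
qed

text \<open>Components 1, 2, 4 and 5 are solved for directly in \<open>frame_coords\<close>. Only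
  the third needs the elimination, and with it a nonzero \<open>schur x\<close>.\<close>

lemma clan_frame_coords:
  assumes "x \<in> pd_cone"
  shows "frame_coords x u \<triangle> x = u"
proof -
  have x: "x $ 1 \<noteq> 0" "x $ 2 \<noteq> 0" "schur x \<noteq> 0" using assms by (auto simp: pd_cone_eq)
  have "frame_coord3 x u * schur x =
     u $ 3 - (2 * u $ 4 - u $ 1 / x $ 1 * x $ 4) * x $ 4 / x $ 1
            - (2 * u $ 5 - u $ 2 / x $ 2 * x $ 5) * x $ 5 / x $ 2"
    using x by (simp add: frame_coord3_def)
  moreover have "(frame_coords x u \<triangle> x) $ 3 = frame_coord3 x u * schur x
     + (2 * u $ 4 - u $ 1 / x $ 1 * x $ 4) * x $ 4 / x $ 1
     + (2 * u $ 5 - u $ 2 / x $ 2 * x $ 5) * x $ 5 / x $ 2"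
    using x(1,2) by (simp add: clan_nth frame_coords_def schur_def field_simps power2_eq_square)
  ultimately have "(frame_coords x u \<triangle> x) $ 3 = u $ 3" by simp
  then show ?thesis
    using x(1,2) by (simp add: frame_coords_def vec_eq_iff forall_5 clan_nth)
qed

lemma bounded_bilinear_clan: "bounded_bilinear (\<triangle>)"
  unfolding bilinear_conv_bounded_bilinear[symmetric] bilinear_def linear_iff
  by (simp add: vec_eq_iff forall_5 clan_nth algebra_simps add_divide_distrib)

lemma bounded_bilinear_clan_form: "bounded_bilinear clan_form"
  unfolding bilinear_conv_bounded_bilinear[symmetric] bilinear_def linear_iff
  by (simp add: clan_form_eq algebra_simps add_divide_distrib)

interpretation clan: bounded_bilinear "(\<triangle>)" by (rule bounded_bilinear_clan)
interpretation clan_form: bounded_bilinear clan_form by (rule bounded_bilinear_clan_form)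

text \<open>The inverse of a linear bijection is linear, so the explicit formula is not
  expanded.\<close>

lemma linear_frame_coords:
  assumes "x \<in> pd_cone"
  shows "linear (frame_coords x)"
  by (rule linearI)
    (metis assms clan.add_left clan.scaleR_left clan_frame_coords frame_coords_clan)+

text \<open>The coordinates are rational in \<open>x\<close> and \<open>Y x\<close>, and the
  variable denominators are \<open>x $ 1\<close>, \<open>x $ 2\<close> and \<open>schur x\<close>,
  all positive on the cone.\<close>

lemma smooth_on_frame_coords:
  assumes "smooth_on pd_cone Y"
  shows "smooth_on pd_cone (\<lambda>x. frame_coords x (Y x))"
proof -
  note Y = smooth_on_nth[OF open_pd_cone assms]
  note x = smooth_on_nth[OF open_pd_cone smooth_on_linear[OF open_pd_cone bounded_linear_ident]]
  note [simp] = pd_cone_eq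
  note rules = smooth_on_add smooth_on_minus smooth_on_mult smooth_on_divide smooth_on_const
    open_pd_cone Y x
  have schur: "smooth_on pd_cone schur"
    unfolding schur_def power2_eq_square by (intro rules) auto
  have coord3: "smooth_on pd_cone (\<lambda>x. frame_coord3 x (Y x))"
    unfolding frame_coord3_def by (intro rules schur) auto
  have "\<forall>i. smooth_on pd_cone (\<lambda>x. frame_coords x (Y x) $ i)"
    unfolding forall_5 frame_coords_def vector_5 by (intro conjI rules coord3) auto
  then show ?thesis by (intro smooth_on_vec open_pd_cone) auto
qed


section \<open>The metric\<close>

lemma clan_form_pos: "c \<noteq> 0 \<Longrightarrow> 0 < clan_form c c"
proof -
  assume "c \<noteq> 0"
  then have "c $ 1 \<noteq> 0 \<or> c $ 2 \<noteq> 0 \<or> c $ 3 \<noteq> 0 \<or> c $ 4 \<noteq> 0 \<or> c $ 5 \<noteq> 0"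
    by (auto simp: vec_eq_iff forall_5)
  then have "0 < c $ 1 * c $ 1 \<or> 0 < c $ 2 * c $ 2 \<or> 0 < c $ 3 * c $ 3 \<or>
      0 < c $ 4 * c $ 4 \<or> 0 < c $ 5 * c $ 5"
    by (metis not_real_square_gt_zero)
  moreover have "0 \<le> c $ 1 * c $ 1" "0 \<le> c $ 2 * c $ 2" "0 \<le> c $ 3 * c $ 3"
    "0 \<le> c $ 4 * c $ 4" "0 \<le> c $ 5 * c $ 5" by simp_all
  \<comment> \<open>Reassociation exposes each square as one atom, and the claim becomes linear with
    positive coefficients.\<close>
  ultimately show ?thesis unfolding clan_form_eq mult.assoc by linarith
qed

lemma clan_form_sym: "clan_form u v = clan_form v u"
  by (simp add: clan_form_eq mult_ac)

abbreviation (input) is_clan_metric :: "(real^5 \<Rightarrow> real^5 \<Rightarrow> real^5 \<Rightarrow> real) \<Rightarrow> bool" where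
  "is_clan_metric g \<equiv> riemannian_metric pd_cone g \<and>
     (\<forall>x\<in>pd_cone. \<forall>u v. g x (clan_field u x) (clan_field v x) = clan_form u v)"

definition frame_metric :: "real^5 \<Rightarrow> real^5 \<Rightarrow> real^5 \<Rightarrow> real" where
  "frame_metric = (\<lambda>x\<in>pd_cone. \<lambda>u v. clan_form (frame_coords x u) (frame_coords x v))"

lemma is_clan_metric_frame_metric: "is_clan_metric frame_metric"
  unfolding riemannian_metric_def
proof (intro conjI ballI allI impI)
  show "frame_metric \<in> extensional pd_cone" by (simp add: frame_metric_def)
  fix x assume x: "x \<in> pd_cone"
  note [simp] = linear_add[OF linear_frame_coords[OF x]] linear_cmul[OF linear_frame_coords[OF x]]
  show "bilinear (frame_metric x)"
    using x unfolding bilinear_def linear_iff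
    by (simp add: frame_metric_def clan_form.add_left clan_form.add_right
        clan_form.scaleR_left clan_form.scaleR_right)
  show "frame_metric x u v = frame_metric x v u" for u v
    using x by (simp add: frame_metric_def clan_form_sym)
  show "0 < frame_metric x u u" if "u \<noteq> 0" for u
  proof -
    have "frame_coords x u \<noteq> 0"
      using clan_frame_coords[OF x, of u] that clan.zero_left by metis
    then show ?thesis using x by (simp add: frame_metric_def clan_form_pos)
  qed
  show "frame_metric x (clan_field u x) (clan_field v x) = clan_form u v" for u v
    using x by (simp add: frame_metric_def clan_field_def frame_coords_clan)
next
  fix u v
  show "smooth_on pd_cone (\<lambda>x. frame_metric x u v)"
  proof (rule smooth_on_cong[OF open_pd_cone])
    show "smooth_on pd_cone (\<lambda>x. clan_form (frame_coords x u) (frame_coords x v))"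
      by (intro smooth_on_bilinear[OF _ bounded_bilinear_clan_form] open_pd_cone
          smooth_on_frame_coords smooth_on_const)
  qed (simp add: frame_metric_def)
qed

text \<open>At each point of the cone every tangent vector is the value of some clan field, so the
  prescribed values fix the whole bilinear form. Off the cone extensionality decides.\<close>

lemma is_clan_metric_unique:
  assumes "is_clan_metric g"
  shows "g = frame_metric"
proof (rule extensionalityI[of _ pd_cone])
  show "g x = frame_metric x" if "x \<in> pd_cone" for x
  proof (intro ext)
    fix u v
    have "g x (clan_field (frame_coords x u) x) (clan_field (frame_coords x v) x) =
        clan_form (frame_coords x u) (frame_coords x v)"
      using assms that by blast
    then show "g x u v = frame_metric x u v"
      using that by (simp add: clan_field_def clan_frame_coords frame_metric_def)
  qed
qed (use assms in \<open>simp_all add: riemannian_metric_def frame_metric_def\<close>)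

lemma clan_metric_eq: "clan_metric = frame_metric"
  unfolding clan_metric_def
  using is_clan_metric_frame_metric is_clan_metric_unique by (rule the_equality)


section \<open>The connection\<close>

lemma vector_fieldsI:
  assumes "open S" "smooth_on S f"
  shows "(\<lambda>x\<in>S. f x) \<in> vector_fields S"
  using smooth_on_cong[OF assms(1) _ assms(2), of "\<lambda>x\<in>S. f x"] by (simp add: vector_fields_def)

lemma vector_fieldsD: "X \<in> vector_fields S \<Longrightarrow> smooth_on S X"
  by (simp add: vector_fields_def)

lemma clan_field_vector_field: "clan_field v \<in> vector_fields pd_cone"
  unfolding clan_field_def
  by (intro vector_fieldsI smooth_on_linear open_pd_cone clan.bounded_linear_right)

text \<open>The flat connection for which the clan frame is parallel: the derivative of the
  coordinates of \<open>Y\<close> along \<open>X\<close> is again a coordinate vector, and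
  \<open>\<triangle> x\<close> turns it into a tangent vector.\<close>

definition frame_connection ::
    "(real^5 \<Rightarrow> real^5) \<Rightarrow> (real^5 \<Rightarrow> real^5) \<Rightarrow> (real^5 \<Rightarrow> real^5)" where
  "frame_connection = (\<lambda>X\<in>vector_fields pd_cone. \<lambda>Y\<in>vector_fields pd_cone. \<lambda>x\<in>pd_cone.
     frechet_derivative (\<lambda>y. frame_coords y (Y y)) (at x) (X x) \<triangle> x)"

lemma frame_connectionI:
  assumes "X \<in> vector_fields pd_cone" "Y \<in> vector_fields pd_cone" "x \<in> pd_cone"
    "((\<lambda>y. frame_coords y (Y y)) has_derivative d) (at x)"
  shows "frame_connection X Y x = d (X x) \<triangle> x"
  using assms(1-3) by (simp add: frame_connection_def frechet_derivative_at[OF assms(4), symmetric])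

lemma frame_coords_has_derivative:
  assumes "smooth_on pd_cone Y" "x \<in> pd_cone"
  shows "((\<lambda>y. frame_coords y (Y y)) has_derivative
    frechet_derivative (\<lambda>y. frame_coords y (Y y)) (at x)) (at x)"
  by (rule smooth_on_has_derivative[OF smooth_on_frame_coords]) (rule assms)+

text \<open>The laws in the first field are linearity of a derivative; those in the second are the
  sum and product rules. The extra Leibniz term is a multiple of
  \<open>frame_coords x (Y x) \<triangle> x\<close>, which is \<open>Y x\<close>.\<close>

lemma affine_connection_frame_connection: "affine_connection pd_cone frame_connection"
  unfolding affine_connection_def
proof (intro conjI ballI allI impI)
  have "(\<lambda>x\<in>pd_cone. frechet_derivative (\<lambda>y. frame_coords y (Y y)) (at x) (X x) \<triangle> x)
      \<in> vector_fields pd_cone"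
    if "X \<in> vector_fields pd_cone" "Y \<in> vector_fields pd_cone" for X Y
    using that
    by (intro vector_fieldsI open_pd_cone smooth_on_bilinear[OF _ bounded_bilinear_clan]
        smooth_on_directional_derivative smooth_on_frame_coords smooth_on_linear
        bounded_linear_ident vector_fieldsD)
  then show "frame_connection \<in>
      vector_fields pd_cone \<rightarrow>\<^sub>E vector_fields pd_cone \<rightarrow>\<^sub>E vector_fields pd_cone"
    unfolding frame_connection_def by auto
next
  fix X Y x
  assume X: "X \<in> vector_fields pd_cone" and Y: "Y \<in> vector_fields pd_cone" and x: "x \<in> pd_cone"
  note smooth = vector_fieldsD[OF X] vector_fieldsD[OF Y]
  note dY = frame_coords_has_derivative[OF smooth(2) x]
  note transform = has_derivative_transform_within_open[OF _ open_pd_cone x]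
  {
    fix Z assume Z: "Z \<in> vector_fields pd_cone"
    note dZ = frame_coords_has_derivative[OF vector_fieldsD[OF Z] x]
    have XY: "(\<lambda>y\<in>pd_cone. X y + Y y) \<in> vector_fields pd_cone"
      and YZ: "(\<lambda>y\<in>pd_cone. Y y + Z y) \<in> vector_fields pd_cone"
      using smooth vector_fieldsD[OF Z] by (auto intro!: vector_fieldsI smooth_on_add open_pd_cone)
    show "frame_connection (\<lambda>y\<in>pd_cone. X y + Y y) Z x =
        frame_connection X Z x + frame_connection Y Z x"
      using x
      by (simp add: frame_connectionI[OF XY Z x dZ] frame_connectionI[OF X Z x dZ]
          frame_connectionI[OF Y Z x dZ] linear_add[OF has_derivative_linear[OF dZ]] clan.add_left)
    have "((\<lambda>y. frame_coords y ((\<lambda>y\<in>pd_cone. Y y + Z y) y)) has_derivative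
        (\<lambda>v. frechet_derivative (\<lambda>y. frame_coords y (Y y)) (at x) v
           + frechet_derivative (\<lambda>y. frame_coords y (Z y)) (at x) v)) (at x)"
      by (rule transform[OF has_derivative_add[OF dY dZ]])
        (simp add: linear_add[OF linear_frame_coords])
    from frame_connectionI[OF X YZ x this]
    show "frame_connection X (\<lambda>y\<in>pd_cone. Y y + Z y) x =
        frame_connection X Y x + frame_connection X Z x"
      by (simp add: frame_connectionI[OF X Y x dY] frame_connectionI[OF X Z x dZ] clan.add_left
          del: restrict_apply)
  }
  fix f :: "real^5 \<Rightarrow> real" assume f: "smooth_on pd_cone f"
  note df = smooth_on_has_derivative[OF f x]
  have fX: "(\<lambda>y\<in>pd_cone. f y *\<^sub>R X y) \<in> vector_fields pd_cone"
    and fY: "(\<lambda>y\<in>pd_cone. f y *\<^sub>R Y y) \<in> vector_fields pd_cone"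
    using smooth f by (auto intro!: vector_fieldsI smooth_on_scaleR open_pd_cone)
  show "frame_connection (\<lambda>y\<in>pd_cone. f y *\<^sub>R X y) Y x = f x *\<^sub>R frame_connection X Y x"
    using x
    by (simp add: frame_connectionI[OF fX Y x dY] frame_connectionI[OF X Y x dY]
        linear_cmul[OF has_derivative_linear[OF dY]] clan.scaleR_left)
  have "((\<lambda>y. frame_coords y ((\<lambda>y\<in>pd_cone. f y *\<^sub>R Y y) y)) has_derivative
      (\<lambda>v. f x *\<^sub>R frechet_derivative (\<lambda>y. frame_coords y (Y y)) (at x) v
         + frechet_derivative f (at x) v *\<^sub>R frame_coords x (Y x))) (at x)"
    by (rule transform[OF has_derivative_scaleR[OF df dY]])
      (simp add: linear_cmul[OF linear_frame_coords])
  from frame_connectionI[OF X fY x this]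
  show "frame_connection X (\<lambda>y\<in>pd_cone. f y *\<^sub>R Y y) x =
      lie_deriv X f x *\<^sub>R Y x + f x *\<^sub>R frame_connection X Y x"
    by (simp add: frame_connectionI[OF X Y x dY] clan.add_left clan.scaleR_left
        clan_frame_coords[OF x] lie_deriv_def del: restrict_apply)
qed

text \<open>On the cone \<open>clan_field v\<close> has the constant coordinates \<open>v\<close>,
  whose derivative is zero.\<close>

lemma frame_connection_clan_field:
  assumes "x \<in> pd_cone"
  shows "frame_connection (clan_field u) (clan_field v) x = 0"
proof -
  have "((\<lambda>y. frame_coords y (clan_field v y)) has_derivative (\<lambda>_. 0)) (at x)"
    by (rule has_derivative_transform_within_open[OF has_derivative_const open_pd_cone assms])
      (simp add: clan_field_def frame_coords_clan)
  from frame_connectionI[OF clan_field_vector_field clan_field_vector_field assms this]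
  show ?thesis by (simp add: clan.zero_left)
qed

section \<open>Uniqueness of the connection by expansion in the frame\<close>

lemma affine_connection_add:
  assumes "affine_connection S D" "X \<in> vector_fields S" "Y \<in> vector_fields S"
    "Z \<in> vector_fields S" "x \<in> S"
  shows "D (\<lambda>y\<in>S. X y + Y y) Z x = D X Z x + D Y Z x"
    and "D X (\<lambda>y\<in>S. Y y + Z y) x = D X Y x + D X Z x"
  using assms unfolding affine_connection_def by blast+

lemma affine_connection_scale:
  assumes "affine_connection S D" "smooth_on S f" "X \<in> vector_fields S" "Y \<in> vector_fields S"
    "x \<in> S"
  shows "D (\<lambda>y\<in>S. f y *\<^sub>R X y) Y x = f x *\<^sub>R D X Y x"
    and "D X (\<lambda>y\<in>S. f y *\<^sub>R Y y) x = lie_deriv X f x *\<^sub>R Y x + f x *\<^sub>R D X Y x"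
  using assms unfolding affine_connection_def by blast+

lemma lie_deriv_const: "lie_deriv X (\<lambda>y. c) x = 0"
  by (simp add: lie_deriv_def)

lemma affine_connection_sum:
  fixes F :: "'i \<Rightarrow> 'a::euclidean_space \<Rightarrow> 'a"
  assumes "open S" "affine_connection S D" "\<And>i. smooth_on S (f i)"
    "\<And>i. F i \<in> vector_fields S" "X \<in> vector_fields S" "x \<in> S" "finite I"
  shows "D (\<lambda>y\<in>S. \<Sum>i\<in>I. f i y *\<^sub>R F i y) X x = (\<Sum>i\<in>I. f i x *\<^sub>R D (F i) X x)"
    and "D X (\<lambda>y\<in>S. \<Sum>i\<in>I. f i y *\<^sub>R F i y) x =
      (\<Sum>i\<in>I. lie_deriv X (f i) x *\<^sub>R F i x + f i x *\<^sub>R D X (F i) x)"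
proof -
  have summand: "(\<lambda>y\<in>S. f i y *\<^sub>R F i y) \<in> vector_fields S" for i
    by (intro vector_fieldsI smooth_on_scaleR assms(1,3) vector_fieldsD assms(4))
  have partial: "(\<lambda>y\<in>S. \<Sum>i\<in>I. f i y *\<^sub>R F i y) \<in> vector_fields S" for I
    by (intro vector_fieldsI smooth_on_sum smooth_on_scaleR assms(1,3) vector_fieldsD assms(4))
  have step: "(\<lambda>y\<in>S. \<Sum>i\<in>insert j I. f i y *\<^sub>R F i y) =
      (\<lambda>y\<in>S. (\<lambda>y\<in>S. f j y *\<^sub>R F j y) y + (\<lambda>y\<in>S. \<Sum>i\<in>I. f i y *\<^sub>R F i y) y)"
    if "finite I" "j \<notin> I" for I j
    using that by (auto intro!: restrict_ext)
  \<comment> \<open>For the empty sum, the zero field is written as the constant function 0 times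
    \<open>X\<close>, so that the scaling laws give its covariant derivative.\<close>
  have zero: "smooth_on S (\<lambda>_. 0 :: real)" by (rule smooth_on_const[OF assms(1)])
  show "D (\<lambda>y\<in>S. \<Sum>i\<in>I. f i y *\<^sub>R F i y) X x = (\<Sum>i\<in>I. f i x *\<^sub>R D (F i) X x)"
    using assms(7)
  proof (induction I)
    case empty
    then show ?case
      using affine_connection_scale(1)[OF assms(2) zero assms(5,5,6)] by (simp del: restrict_apply)
  next
    case (insert j I)
    then show ?case
      unfolding step[OF insert.hyps] affine_connection_add(1)[OF assms(2) summand partial assms(5,6)]
      by (simp add: affine_connection_scale(1)[OF assms(2,3,4,5,6)] del: restrict_apply)
  qed
  show "D X (\<lambda>y\<in>S. \<Sum>i\<in>I. f i y *\<^sub>R F i y) x =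
      (\<Sum>i\<in>I. lie_deriv X (f i) x *\<^sub>R F i x + f i x *\<^sub>R D X (F i) x)"
    using assms(7)
  proof (induction I)
    case empty
    then show ?case
      using affine_connection_scale(2)[OF assms(2) zero assms(5,5,6)]
      by (simp add: lie_deriv_const del: restrict_apply)
  next
    case (insert j I)
    then show ?case
      unfolding step[OF insert.hyps] affine_connection_add(2)[OF assms(2,5) summand partial assms(6)]
      by (simp add: affine_connection_scale(2)[OF assms(2,3,5,4,6)] del: restrict_apply)
  qed
qed

lemma sum_clan_field:
  "x \<in> pd_cone \<Longrightarrow> (\<Sum>i\<in>UNIV. c $ i *\<^sub>R clan_field (axis i 1) x) = c \<triangle> x"
proof -
  assume "x \<in> pd_cone"
  then have "(\<Sum>i\<in>UNIV. c $ i *\<^sub>R clan_field (axis i 1) x) = (\<Sum>i\<in>UNIV. c $ i *\<^sub>R axis i 1) \<triangle> x"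
    by (simp add: clan_field_def clan.sum_left clan.scaleR_left)
  then show ?thesis by (simp add: vec_sum_axis)
qed

lemma vector_field_eq_sum_clan_field:
  assumes "X \<in> vector_fields pd_cone"
  shows "X = (\<lambda>y\<in>pd_cone. \<Sum>i\<in>UNIV. frame_coords y (X y) $ i *\<^sub>R clan_field (axis i 1) y)"
  using assms
  by (intro extensionalityI[of _ pd_cone])
    (simp_all add: vector_fields_def sum_clan_field clan_frame_coords)

abbreviation (input) is_clan_connection ::
    "((real^5 \<Rightarrow> real^5) \<Rightarrow> (real^5 \<Rightarrow> real^5) \<Rightarrow> (real^5 \<Rightarrow> real^5)) \<Rightarrow> bool" where
  "is_clan_connection D \<equiv> affine_connection pd_cone D \<and>
     (\<forall>u v. \<forall>x\<in>pd_cone. D (clan_field u) (clan_field v) x = 0)"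

text \<open>Expanding both fields in the clan frame leaves a formula for \<open>D X Y x\<close> that
  no longer mentions \<open>D\<close>.\<close>

lemma is_clan_connection_unique:
  assumes D: "is_clan_connection D" and D': "is_clan_connection D'"
  shows "D = D'"
proof -
  have formula: "D X Y x =
      (\<Sum>i\<in>UNIV. lie_deriv X (\<lambda>y. frame_coords y (Y y) $ i) x *\<^sub>R clan_field (axis i 1) x)"
    if D: "is_clan_connection D" and X: "X \<in> vector_fields pd_cone"
      and Y: "Y \<in> vector_fields pd_cone" and x: "x \<in> pd_cone" for D X Y x
  proof -
    have smooth: "smooth_on pd_cone (\<lambda>y. frame_coords y (Z y) $ i)"
      if "Z \<in> vector_fields pd_cone" for Z i
      by (intro smooth_on_nth smooth_on_frame_coords vector_fieldsD that open_pd_cone)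
    note conn = conjunct1[OF D]
    \<comment> \<open>Linearity over functions in the first argument extends the vanishing from clan
      fields to every \<open>X\<close>. The Leibniz rule for \<open>Y\<close> then keeps only the
      derivatives of its coefficients.\<close>
    have "D X (clan_field v) x = 0" for v
      using affine_connection_sum(1)[OF open_pd_cone conn smooth[OF X] clan_field_vector_field
          clan_field_vector_field x finite] D x
      by (subst vector_field_eq_sum_clan_field[OF X]) simp
    then show ?thesis
      using affine_connection_sum(2)[OF open_pd_cone conn smooth[OF Y] clan_field_vector_field
          X x finite]
      by (subst vector_field_eq_sum_clan_field[OF Y]) simp
  qed
  \<comment> \<open>The formula only covers vector fields and points of the cone; the extensional
    function spaces settle all other arguments.\<close>
  have ext: "D \<in> vector_fields pd_cone \<rightarrow>\<^sub>E vector_fields pd_cone \<rightarrow>\<^sub>E vector_fields pd_cone"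
    "D' \<in> vector_fields pd_cone \<rightarrow>\<^sub>E vector_fields pd_cone \<rightarrow>\<^sub>E vector_fields pd_cone"
    using D D' by (simp_all add: affine_connection_def)
  show ?thesis
  proof (rule PiE_ext[OF ext])
    fix X assume X: "X \<in> vector_fields pd_cone"
    note DX = PiE_mem[OF ext(1) X] PiE_mem[OF ext(2) X]
    show "D X = D' X"
    proof (rule PiE_ext[OF DX])
      fix Y assume Y: "Y \<in> vector_fields pd_cone"
      show "D X Y = D' X Y"
        using PiE_mem[OF DX(1) Y] PiE_mem[OF DX(2) Y] formula[OF D X Y] formula[OF D' X Y]
        by (intro extensionalityI[of _ pd_cone]) (simp_all add: vector_fields_def)
    qed
  qed
qed

lemma clan_connection_eq: "clan_connection = frame_connection"
  unfolding clan_connection_def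
proof (rule the_equality)
  show "is_clan_connection frame_connection"
    using affine_connection_frame_connection frame_connection_clan_field by blast
  then show "D = frame_connection" if "is_clan_connection D" for D
    using that by (rule is_clan_connection_unique[rotated])
qed

lemma parallel_frame_metric: "parallel_metric pd_cone frame_connection frame_metric"
  unfolding parallel_metric_def
proof (intro ballI)
  fix X Y Z x
  assume X: "X \<in> vector_fields pd_cone" and Y: "Y \<in> vector_fields pd_cone"
    and Z: "Z \<in> vector_fields pd_cone" and x: "x \<in> pd_cone"
  note dY = frame_coords_has_derivative[OF vector_fieldsD[OF Y] x]
  note dZ = frame_coords_has_derivative[OF vector_fieldsD[OF Z] x]
  have "((\<lambda>y. frame_metric y (Y y) (Z y)) has_derivative
      (\<lambda>v. clan_form (frame_coords x (Y x)) (frechet_derivative (\<lambda>y. frame_coords y (Z y)) (at x) v)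
         + clan_form (frechet_derivative (\<lambda>y. frame_coords y (Y y)) (at x) v) (frame_coords x (Z x))))
      (at x)"
    by (rule has_derivative_transform_within_open[OF clan_form.FDERIV[OF dY dZ] open_pd_cone x])
      (simp add: frame_metric_def)
  \<comment> \<open>By \<open>frame_coords_clan\<close> the coordinates of a covariant derivative
    are the differentiated coordinates. Hence the two product rule terms are exactly those
    subtracted in \<open>cov_deriv_metric\<close>.\<close>
  from frechet_derivative_at[OF this, symmetric]
  show "cov_deriv_metric frame_connection frame_metric X Y Z x = 0"
    by (simp add: cov_deriv_metric_def lie_deriv_def frame_connectionI[OF X Y x dY]
        frame_connectionI[OF X Z x dZ] frame_metric_def x frame_coords_clan)
qed

theorem proposition6p15:
  shows "(\<exists>!g. riemannian_metric pd_cone g \<and>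
            (\<forall>x\<in>pd_cone. \<forall>u v. g x (clan_field u x) (clan_field v x) = clan_form u v)) \<and>
         (\<forall>x\<in>pd_cone. \<forall>(c::real^5) (d::real^5).
            clan_metric x (\<Sum>i\<in>UNIV. c $ i *\<^sub>R clan_field (axis i 1) x)
                          (\<Sum>i\<in>UNIV. d $ i *\<^sub>R clan_field (axis i 1) x)
            = 3 / 2 * c $ 1 * d $ 1 + 3 / 2 * c $ 2 * d $ 2 + 2 * c $ 3 * d $ 3
              + 4 * c $ 4 * d $ 4 + 4 * c $ 5 * d $ 5) \<and>
         parallel_metric pd_cone clan_connection clan_metric"
proof (intro conjI ballI allI)
  show "\<exists>!g. is_clan_metric g"
    using is_clan_metric_frame_metric is_clan_metric_unique by (rule ex1I)
  show "clan_metric x (\<Sum>i\<in>UNIV. c $ i *\<^sub>R clan_field (axis i 1) x)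
                          (\<Sum>i\<in>UNIV. d $ i *\<^sub>R clan_field (axis i 1) x)
            = 3 / 2 * c $ 1 * d $ 1 + 3 / 2 * c $ 2 * d $ 2 + 2 * c $ 3 * d $ 3
              + 4 * c $ 4 * d $ 4 + 4 * c $ 5 * d $ 5" if "x \<in> pd_cone" for x c d
    using that
    by (simp add: sum_clan_field clan_metric_eq frame_metric_def frame_coords_clan clan_form_eq)
  show "parallel_metric pd_cone clan_connection clan_metric"
    unfolding clan_connection_eq clan_metric_eq by (rule parallel_frame_metric)
qed

end
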